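(* Let each $F_i:\mathbb{R}^n\to\mathbb{R}^n$, $i\in[m]$, be continuous and monotone, let $X\subseteq\mathbb{R}^n$ be nonempty, convex and compact, and let each $f_i:\mathbb{R}^n\to\mathbb{R}$ be continuously differentiable and $\mu_{f_i}$-strongly convex over $X$. Let $\mu_{\min}=\min_{i\in[m]}\mu_{f_i}>0$. Let $\gamma_k:=\frac{\gamma}{(k+\Gamma)^a}$ and $\eta_k:=\frac{\eta}{(k+\Gamma)^b}$ for all $k\ge0$, where $\gamma,\eta,\Gamma,a,b$ are strictly positive scalars with $a>b$, $a+b<1$, $3a+b<2$, $\Gamma\ge1$, $\Gamma^{a+b}\ge 2\gamma\eta\mu_{\min}$ and $\Gamma^{1-a-b}\ge\frac{4}{\gamma\eta\mu_{\min}}$. Let $\{x_{k,i}\}$ be generated by the incremental scheme described in the context with these sequences, let $x_k=x_{k,1}$, and let $\{x^*_{\eta_k}\}$ be the Tikhonov trajectory, i.e., $x^*_{\eta_k}$ is the unique solution of $\mathrm{VI}(X,\sum_{i=1}^m(F_i+\eta_k\nabla f_i))$. Then for all $k\ge0$ and all $i\in[m]$, $$\|x_{k+1,i}-x^*_{\eta_k}\|^2\le\frac{2(i-1)^2(C_F+\eta_0C_f)^2\gamma^2}{m^2(k+\Gamma+1)^{2a}}+\frac{2\tau B_0\gamma}{\mu_{\min}\eta(k+\Gamma)^{a-b}},$$ where $$\tau=\max\left\{\mu_{\min}\eta\gamma^{-1}B_0^{-1}\Gamma^{a-b}\|x_1-x^*_{\eta_0}\|^2,\,2\right\},\qquad 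B_0=\frac{1.5C_f^2}{m^2\mu_{\min}^3\gamma^3\eta\Gamma^{2-3a-b}}+(C_F+\eta_0C_f)^2.$$
   Context: Notation: $[m]=\{1,\dots,m\}$; $\|\cdot\|$ is the Euclidean norm; $\mathcal{P}_X$ is Euclidean projection onto $X$. For a mapping $G$, $x\in X$ solves $\mathrm{VI}(X,G)$ if $(y-x)^TG(x)\ge0$ for all $y\in X$. $C_F>0$ and $C_f>0$ are scalars such that for all $i\in[m]$ and $x\in X$: $\|F_i(x)\|\le C_F/m$ and $\|\nabla f_i(x)\|\le C_f/m$. Scheme: choose $x_{0,1}\in X$ arbitrarily. For $k=0,1,2,\dots$: for $i=1,\dots,m$ set $$x_{k,i+1}=\mathcal{P}_X\big(x_{k,i}-\gamma_k(F_i(x_{k,i})+\eta_k\nabla f_i(x_{k,i}))\big),$$ then set $x_{k+1,1}=x_{k,m+1}$. Define $x_0=x_{0,1}$ and $x_k=x_{k-1,m+1}=x_{k,1}$ for $k\ge1$. *)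

theory Defs
  imports "HOL-Analysis.Analysis"
begin

definition monotone_operator :: "('a::real_inner \<Rightarrow> 'a) \<Rightarrow> bool" where
  "monotone_operator G \<longleftrightarrow> (\<forall>x y. 0 \<le> (G x - G y) \<bullet> (x - y))"

definition strongly_convex_on :: "'a::real_inner set \<Rightarrow> real \<Rightarrow> ('a \<Rightarrow> real) \<Rightarrow> bool" where
  "strongly_convex_on X \<mu> f \<longleftrightarrow>
     convex X \<and>
     (\<forall>x\<in>X. \<forall>y\<in>X. \<forall>t\<in>{0..1}.
        f (t *\<^sub>R x + (1 - t) *\<^sub>R y)
          \<le> t * f x + (1 - t) * f y - \<mu> / 2 * t * (1 - t) * (norm (x - y))\<^sup>2)"

definition VI_solution :: "'a::real_inner set \<Rightarrow> ('a \<Rightarrow> 'a) \<Rightarrow> 'a \<Rightarrow> bool" where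
  "VI_solution X G x \<longleftrightarrow> x \<in> X \<and> (\<forall>y\<in>X. 0 \<le> (y - x) \<bullet> G x)"

text \<open>Here \<open>grad i\<close> stands for the gradient field of the \<open>i\<close>-th objective. The description
  is only meaningful where the regularised variational inequality has exactly one solution,
  as it does for compact convex nonempty \<open>X\<close>, continuous monotone \<open>F i\<close>, strongly convex
  continuously differentiable objectives, and \<open>\<epsilon> > 0\<close>, \<open>m \<ge> 1\<close>.\<close>

definition tikhonov_point ::
  "'a::real_inner set \<Rightarrow> nat \<Rightarrow> (nat \<Rightarrow> 'a \<Rightarrow> 'a) \<Rightarrow> (nat \<Rightarrow> 'a \<Rightarrow> 'a) \<Rightarrow> real \<Rightarrow> 'a" where
  "tikhonov_point X m F grad \<epsilon> =
     (THE x. VI_solution X (\<lambda>z. \<Sum>i=1..m. F i z + \<epsilon> *\<^sub>R grad i z) x)"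

end

theory Submission
  imports Defs
begin

text \<open>
  Within one cycle, projected steps move the iterate by at most \<open>\<gamma>\<^sub>k C / m\<close> each, where
  \<open>C = C\<^sub>F + \<eta>\<^sub>0 C\<^sub>f\<close>. Expanding \<open>\<parallel>x\<^bsub>k,i+1\<^esub> - x\<^sup>*\<parallel>\<^sup>2\<close> with nonexpansiveness of the projection,
  comparing \<open>G\<^sub>i(x\<^bsub>k,i\<^esub>)\<close> with \<open>G\<^sub>i(x\<^sup>*)\<close> by strong monotonicity of \<open>G\<^sub>i = F\<^sub>i + \<eta>\<^sub>k \<nabla>f\<^sub>i\<close>, and
  replacing \<open>x\<^bsub>k,i\<^esub>\<close> by \<open>x\<^bsub>k,1\<^esub>\<close> in the remaining linear term makes the terms \<open>G\<^sub>i(x\<^sup>*)\<close> add up to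
  a quantity that the variational inequality makes nonnegative, so a whole cycle satisfies
  \<open>\<parallel>x\<^bsub>k+1\<^esub> - x\<^sup>*\<parallel>\<^sup>2 \<le> (1 - 2 p\<^sub>k) \<parallel>x\<^sub>k - x\<^sup>*\<parallel>\<^sup>2 + \<gamma>\<^sub>k\<^sup>2 C\<^sup>2\<close> with
  \<open>p\<^sub>k = \<gamma>\<^sub>k \<eta>\<^sub>k \<mu>\<^sub>m\<^sub>i\<^sub>n\<close> and \<open>x\<^sup>* = x\<^sup>*\<^bsub>\<eta>\<^sub>k\<^esub>\<close> (\<open>incremental_cycle_contraction\<close>).

  The Tikhonov points drift slowly: adding the two variational inequalities gives
  \<open>\<parallel>x\<^sup>*\<^bsub>\<eta>\<^sub>k\<^esub> - x\<^sup>*\<^bsub>\<eta>\<^sub>k\<^sub>-\<^sub>1\<^esub>\<parallel> \<le> (C\<^sub>f / (m \<mu>\<^sub>m\<^sub>i\<^sub>n)) (\<eta>\<^sub>k\<^sub>-\<^sub>1 / \<eta>\<^sub>k - 1)\<close>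
  (\<open>VI_solution_regularization_lipschitz\<close>), and the ratio exceeds \<open>1\<close> by at most \<open>1 / (k + \<Gamma>)\<close>.
  Young's inequality with parameter \<open>p\<^sub>k\<close> merges both estimates into
  \<open>e\<^bsub>k+1\<^esub> \<le> (1 - p\<^sub>k) e\<^sub>k + B\<^sub>0 \<gamma>\<^sub>k\<^sup>2\<close> with \<open>e\<^bsub>k+1\<^esub> = \<parallel>x\<^bsub>k+1\<^esub> - x\<^sup>*\<^bsub>\<eta>\<^sub>k\<^esub>\<parallel>\<^sup>2\<close>,
  for \<open>k \<ge> 1\<close>. Since \<open>(k + \<Gamma>)\<^bsup>b-a\<^esup>\<close> loses only a fraction \<open>1 / (k + \<Gamma>)\<close> per step, and the lower
  bound on \<open>\<Gamma>\<^bsup>1-a-b\<^esup>\<close> makes this fraction at most \<open>p\<^sub>k / 2\<close>, induction shows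
  that \<open>e\<^bsub>k+1\<^esub>\<close> is at most a constant multiple of \<open>(k + \<Gamma>)\<^bsup>b-a\<^esup>\<close>
  (\<open>power_rate_recursion_step\<close>). An inner iterate is within
  \<open>(i - 1) \<gamma>\<^bsub>k+1\<^esub> C / m\<close> of \<open>x\<^bsub>k+1\<^esub>\<close>, and \<open>\<parallel>u + v\<parallel>\<^sup>2 \<le> 2 \<parallel>u\<parallel>\<^sup>2 + 2 \<parallel>v\<parallel>\<^sup>2\<close> yields the
  stated bound.
\<close>

section \<open>Strong convexity and variational inequalities\<close>

lemma strongly_convex_on_gradient_ineq:
  fixes f :: "'a::real_inner \<Rightarrow> real"
  assumes sc: "strongly_convex_on X \<mu> f" and xy: "x \<in> X" "y \<in> X" and g: "GDERIV f y :> g"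
  shows "f y + g \<bullet> (x - y) + \<mu> / 2 * (norm (x - y))\<^sup>2 \<le> f x"
proof -
  \<comment> \<open>Divide the convexity inequality at \<open>t x + (1 - t) y\<close> by \<open>t\<close> and let \<open>t\<close> tend to \<open>0\<close> from the right.\<close>
  define h where "h t = f (y + t *\<^sub>R (x - y))" for t
  have "(h has_derivative (\<lambda>t. (t *\<^sub>R (x - y)) \<bullet> g)) (at 0)"
    unfolding h_def
    by (rule has_derivative_compose[where f = "\<lambda>t. y + t *\<^sub>R (x - y)" and g = f])
       (use g in \<open>auto simp: gderiv_def inner_commute intro!: derivative_eq_intros\<close>)
  then have "(h has_field_derivative ((x - y) \<bullet> g)) (at 0)"
    by (rule has_derivative_imp_has_field_derivative) (simp add: mult.commute)
  then have "((\<lambda>t. (h t - h 0) / t) \<longlongrightarrow> (x - y) \<bullet> g) (at 0)"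
    by (simp add: has_field_derivative_iff)
  then have lim: "((\<lambda>t. (h t - h 0) / t) \<longlongrightarrow> (x - y) \<bullet> g) (at_right 0)"
    by (rule tendsto_mono[OF at_le, rotated]) simp
  have lim2: "((\<lambda>t. f x - f y - \<mu> / 2 * (1 - t) * (norm (x - y))\<^sup>2) \<longlongrightarrow>
      f x - f y - \<mu> / 2 * (1 - 0) * (norm (x - y))\<^sup>2) (at_right 0)"
    by (intro tendsto_intros)
  have "\<forall>\<^sub>F t in at_right 0. (h t - h 0) / t \<le> f x - f y - \<mu> / 2 * (1 - t) * (norm (x - y))\<^sup>2"
    unfolding eventually_at_right_field
  proof (intro exI[of _ 1] conjI allI impI)
    fix t :: real
    assume t: "0 < t" "t < 1"
    have "f (t *\<^sub>R x + (1 - t) *\<^sub>R y)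
        \<le> t * f x + (1 - t) * f y - \<mu> / 2 * t * (1 - t) * (norm (x - y))\<^sup>2"
      using sc xy t by (auto simp: strongly_convex_on_def)
    moreover have "t *\<^sub>R x + (1 - t) *\<^sub>R y = y + t *\<^sub>R (x - y)"
      by (simp add: algebra_simps)
    ultimately have "h t - h 0 \<le> (f x - f y - \<mu> / 2 * (1 - t) * (norm (x - y))\<^sup>2) * t"
      by (simp add: h_def algebra_simps)
    then show "(h t - h 0) / t \<le> f x - f y - \<mu> / 2 * (1 - t) * (norm (x - y))\<^sup>2"
      using t by (simp add: pos_divide_le_eq)
  qed simp
  from tendsto_le[OF _ lim2 lim this] show ?thesis
    by (simp add: inner_commute)
qed

lemma strongly_convex_on_gradient_strongly_monotone:
  fixes f :: "'a::real_inner \<Rightarrow> real"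
  assumes "strongly_convex_on X \<mu> f" "x \<in> X" "y \<in> X" "GDERIV f x :> gx" "GDERIV f y :> gy"
  shows "\<mu> * (norm (x - y))\<^sup>2 \<le> (gx - gy) \<bullet> (x - y)"
proof -
  have "gx \<bullet> (y - x) = - (gx \<bullet> (x - y))"
    by (simp add: inner_diff_right)
  then show ?thesis
    using strongly_convex_on_gradient_ineq[OF assms(1,2,3,5)]
      strongly_convex_on_gradient_ineq[OF assms(1,3,2,4)]
    by (simp add: inner_diff_left norm_minus_commute)
qed

text \<open>Solutions are the fixed points of \<open>z \<mapsto> P\<^sub>X(z - G z)\<close>, which exist by Brouwer's theorem.\<close>

lemma VI_solution_exists:
  fixes G :: "'a::euclidean_space \<Rightarrow> 'a"
  assumes X: "X \<noteq> {}" "convex X" "compact X" and G: "continuous_on X G"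
  shows "\<exists>z. VI_solution X G z"
proof -
  have cl: "closed X" using X by (simp add: compact_imp_closed)
  obtain z where z: "z \<in> X" "closest_point X (z - G z) = z"
  proof (rule brouwer[OF X(3,2,1)])
    show "continuous_on X (\<lambda>z. closest_point X (z - G z))"
      by (rule continuous_on_compose2[OF continuous_on_closest_point[OF X(2) cl X(1), of UNIV]])
         (auto intro!: continuous_intros G)
    show "(\<lambda>z. closest_point X (z - G z)) \<in> X \<rightarrow> X"
      using closest_point_in_set[OF cl X(1)] by auto
  qed
  have "0 \<le> (y - z) \<bullet> G z" if "y \<in> X" for y
    using closest_point_dot[OF X(2) cl that, of "z - G z"] z
    by (simp add: inner_commute)
  with z show ?thesis by (auto simp: VI_solution_def)
qed

text \<open>The regularisation parameter changes from \<open>\<epsilon>'\<close> to \<open>\<epsilon>\<close>; taking \<open>\<epsilon>' = \<epsilon>\<close> gives uniqueness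
  of the solution.\<close>

lemma VI_solution_regularization_lipschitz:
  fixes F g :: "'a::real_inner \<Rightarrow> 'a"
  assumes u: "VI_solution X (\<lambda>z. F z + \<epsilon> *\<^sub>R g z) u"
    and v: "VI_solution X (\<lambda>z. F z + \<epsilon>' *\<^sub>R g z) v"
    and F: "0 \<le> (F u - F v) \<bullet> (u - v)"
    and g: "\<nu> * (norm (u - v))\<^sup>2 \<le> (g u - g v) \<bullet> (u - v)"
    and C: "norm (g v) \<le> C" and pos: "\<epsilon> > 0" "\<nu> > 0"
  shows "norm (u - v) \<le> C / \<nu> * (\<bar>\<epsilon>' - \<epsilon>\<bar> / \<epsilon>)"
proof -
  have uv: "0 \<le> (v - u) \<bullet> (F u + \<epsilon> *\<^sub>R g u)" "0 \<le> (u - v) \<bullet> (F v + \<epsilon>' *\<^sub>R g v)"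
    using u v by (auto simp: VI_solution_def)
  have id: "(v - u) \<bullet> (F u + \<epsilon> *\<^sub>R g u) + (u - v) \<bullet> (F v + \<epsilon>' *\<^sub>R g v)
      = - ((F u - F v) \<bullet> (u - v)) - \<epsilon> * ((g u - g v) \<bullet> (u - v)) + (\<epsilon>' - \<epsilon>) * (g v \<bullet> (u - v))"
    by (simp add: inner_diff_left inner_diff_right inner_add_right inner_commute algebra_simps)
  have "\<epsilon> * (\<nu> * (norm (u - v))\<^sup>2) \<le> \<epsilon> * ((g u - g v) \<bullet> (u - v))"
    using g pos by simp
  also have "\<dots> \<le> (\<epsilon>' - \<epsilon>) * (g v \<bullet> (u - v))"
    using uv id F by linarith
  also have "\<dots> \<le> \<bar>\<epsilon>' - \<epsilon>\<bar> * \<bar>g v \<bullet> (u - v)\<bar>"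
    unfolding abs_mult[symmetric] by (rule abs_ge_self)
  also have "\<dots> \<le> \<bar>\<epsilon>' - \<epsilon>\<bar> * (norm (g v) * norm (u - v))"
    by (intro mult_left_mono Cauchy_Schwarz_ineq2) auto
  also have "\<dots> \<le> \<bar>\<epsilon>' - \<epsilon>\<bar> * (C * norm (u - v))"
    using C by (intro mult_left_mono mult_right_mono) auto
  finally have *: "(\<epsilon> * \<nu> * norm (u - v)) * norm (u - v) \<le> (\<bar>\<epsilon>' - \<epsilon>\<bar> * C) * norm (u - v)"
    by (simp add: power2_eq_square mult_ac)
  have "\<epsilon> * \<nu> * norm (u - v) \<le> \<bar>\<epsilon>' - \<epsilon>\<bar> * C"
  proof (cases "u = v")
    case True
    then show ?thesis using order_trans[OF norm_ge_zero C] by simp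
  next
    case False
    then show ?thesis using * by simp
  qed
  then show ?thesis using pos by (simp add: field_simps)
qed

lemma sum_strongly_monotone:
  fixes g :: "nat \<Rightarrow> 'a::real_inner \<Rightarrow> 'a"
  assumes "\<And>i. i \<in> {1..m} \<Longrightarrow> \<nu> * (norm (u - v))\<^sup>2 \<le> (g i u - g i v) \<bullet> (u - v)"
  shows "real m * \<nu> * (norm (u - v))\<^sup>2 \<le> ((\<Sum>i=1..m. g i u) - (\<Sum>i=1..m. g i v)) \<bullet> (u - v)"
proof -
  have "(\<Sum>i=1..m. \<nu> * (norm (u - v))\<^sup>2) \<le> (\<Sum>i=1..m. (g i u - g i v) \<bullet> (u - v))"
    by (intro sum_mono assms)
  then show ?thesis
    by (simp add: inner_sum_left sum_subtractf[symmetric])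
qed

lemma VI_solution_sum_regularization:
  "VI_solution X (\<lambda>z. \<Sum>i=1..m. F i z + \<epsilon> *\<^sub>R grad i z) =
   VI_solution X (\<lambda>z. (\<Sum>i=1..m. F i z) + \<epsilon> *\<^sub>R (\<Sum>i=1..m. grad i z))"
  by (simp add: sum.distrib scaleR_sum_right)

text \<open>Existence and uniqueness hold, so the definite description denotes the solution.\<close>

lemma VI_solution_tikhonov_point:
  fixes F grad :: "nat \<Rightarrow> 'a::euclidean_space \<Rightarrow> 'a"
  assumes X: "X \<noteq> {}" "convex X" "compact X" and m: "m \<ge> 1" and pos: "\<nu> > 0" "\<epsilon> > 0"
    and cont: "\<And>i. i \<in> {1..m} \<Longrightarrow> continuous_on X (F i)"
      "\<And>i. i \<in> {1..m} \<Longrightarrow> continuous_on X (grad i)"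
    and F: "\<And>i u v. i \<in> {1..m} \<Longrightarrow> u \<in> X \<Longrightarrow> v \<in> X \<Longrightarrow> 0 \<le> (F i u - F i v) \<bullet> (u - v)"
    and g: "\<And>i u v. i \<in> {1..m} \<Longrightarrow> u \<in> X \<Longrightarrow> v \<in> X \<Longrightarrow>
      \<nu> * (norm (u - v))\<^sup>2 \<le> (grad i u - grad i v) \<bullet> (u - v)"
  shows "VI_solution X (\<lambda>z. \<Sum>i=1..m. F i z + \<epsilon> *\<^sub>R grad i z) (tikhonov_point X m F grad \<epsilon>)"
  unfolding tikhonov_point_def
proof (rule theI')
  let ?VI = "VI_solution X (\<lambda>z. \<Sum>i=1..m. F i z + \<epsilon> *\<^sub>R grad i z)"
  have "\<exists>z. ?VI z"
    by (intro VI_solution_exists[OF X] continuous_intros cont)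
  moreover have "u = v" if "?VI u" "?VI v" for u v
  proof -
    have uv: "u \<in> X" "v \<in> X" using that by (auto simp: VI_solution_def)
    have "norm (u - v) \<le> norm (\<Sum>i=1..m. grad i v) / (real m * \<nu>) * (\<bar>\<epsilon> - \<epsilon>\<bar> / \<epsilon>)"
    proof (rule VI_solution_regularization_lipschitz)
      show "VI_solution X (\<lambda>z. (\<Sum>i=1..m. F i z) + \<epsilon> *\<^sub>R (\<Sum>i=1..m. grad i z)) u"
        "VI_solution X (\<lambda>z. (\<Sum>i=1..m. F i z) + \<epsilon> *\<^sub>R (\<Sum>i=1..m. grad i z)) v"
        using that unfolding VI_solution_sum_regularization by auto
      show "0 \<le> ((\<Sum>i=1..m. F i u) - (\<Sum>i=1..m. F i v)) \<bullet> (u - v)"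
        using sum_strongly_monotone[of m 0 u v F] F uv by simp
      show "real m * \<nu> * (norm (u - v))\<^sup>2
          \<le> ((\<Sum>i=1..m. grad i u) - (\<Sum>i=1..m. grad i v)) \<bullet> (u - v)"
        by (rule sum_strongly_monotone) (use g uv in auto)
    qed (use m pos in auto)
    then show ?thesis by simp
  qed
  ultimately show "\<exists>!z. ?VI z" by blast
qed

lemma tikhonov_point_drift:
  fixes F grad :: "nat \<Rightarrow> 'a::euclidean_space \<Rightarrow> 'a"
  assumes X: "X \<noteq> {}" "convex X" "compact X" and m: "m \<ge> 1"
    and pos: "\<nu> > 0" "\<epsilon> > 0" "\<epsilon>' > 0"
    and cont: "\<And>i. i \<in> {1..m} \<Longrightarrow> continuous_on X (F i)"
      "\<And>i. i \<in> {1..m} \<Longrightarrow> continuous_on X (grad i)"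
    and F: "\<And>i u v. i \<in> {1..m} \<Longrightarrow> u \<in> X \<Longrightarrow> v \<in> X \<Longrightarrow> 0 \<le> (F i u - F i v) \<bullet> (u - v)"
    and g: "\<And>i u v. i \<in> {1..m} \<Longrightarrow> u \<in> X \<Longrightarrow> v \<in> X \<Longrightarrow>
      \<nu> * (norm (u - v))\<^sup>2 \<le> (grad i u - grad i v) \<bullet> (u - v)"
    and C: "\<And>i z. i \<in> {1..m} \<Longrightarrow> z \<in> X \<Longrightarrow> norm (grad i z) \<le> C / real m"
  shows "norm (tikhonov_point X m F grad \<epsilon> - tikhonov_point X m F grad \<epsilon>')
    \<le> C / (real m * \<nu>) * (\<bar>\<epsilon>' - \<epsilon>\<bar> / \<epsilon>)"
proof (rule VI_solution_regularization_lipschitz)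
  define u v where "u = tikhonov_point X m F grad \<epsilon>" and "v = tikhonov_point X m F grad \<epsilon>'"
  have VI: "VI_solution X (\<lambda>z. \<Sum>i=1..m. F i z + \<epsilon> *\<^sub>R grad i z) u"
    "VI_solution X (\<lambda>z. \<Sum>i=1..m. F i z + \<epsilon>' *\<^sub>R grad i z) v"
    unfolding u_def v_def
    using VI_solution_tikhonov_point[OF X m pos(1,2) cont F g]
      VI_solution_tikhonov_point[OF X m pos(1,3) cont F g] by simp_all
  then have uv: "u \<in> X" "v \<in> X" by (auto simp: VI_solution_def)
  show "VI_solution X (\<lambda>z. (\<Sum>i=1..m. F i z) + \<epsilon> *\<^sub>R (\<Sum>i=1..m. grad i z)) u"
    "VI_solution X (\<lambda>z. (\<Sum>i=1..m. F i z) + \<epsilon>' *\<^sub>R (\<Sum>i=1..m. grad i z)) v"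
    using VI unfolding VI_solution_sum_regularization by auto
  show "0 \<le> ((\<Sum>i=1..m. F i u) - (\<Sum>i=1..m. F i v)) \<bullet> (u - v)"
    using sum_strongly_monotone[of m 0 u v F] F uv by simp
  show "real m * \<nu> * (norm (u - v))\<^sup>2 \<le> ((\<Sum>i=1..m. grad i u) - (\<Sum>i=1..m. grad i v)) \<bullet> (u - v)"
    by (rule sum_strongly_monotone) (use g uv in auto)
  have "norm (\<Sum>i=1..m. grad i v) \<le> (\<Sum>i=1..m. C / real m)"
    by (intro sum_norm_le C uv)
  then show "norm (\<Sum>i=1..m. grad i v) \<le> C" using m by simp
qed (use pos m in auto)

section \<open>One cycle of the incremental projection method\<close>

lemma closest_point_dist_le:
  fixes X :: "'a::euclidean_space set"
  assumes "convex X" "closed X" "w \<in> X"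
  shows "norm (closest_point X z - w) \<le> norm (z - w)"
  using closest_point_lipschitz[of X z w] closest_point_self[of w X] assms
  by (auto simp: dist_norm)

lemma incremental_cycle_in_set:
  fixes y :: "nat \<Rightarrow> 'a::euclidean_space"
  assumes X: "convex X" "closed X" and y1: "y 1 \<in> X"
    and step: "\<And>i. i \<in> {1..m} \<Longrightarrow> y (i + 1) = closest_point X (y i - \<gamma> *\<^sub>R G i (y i))"
  shows "j \<le> m \<Longrightarrow> y (j + 1) \<in> X"
proof (cases j)
  case (Suc i)
  moreover assume "j \<le> m"
  ultimately show ?thesis
    using step[of j] closest_point_in_set[OF X(2)] y1 by auto
qed (use y1 in simp)

lemma incremental_cycle_dist_start:
  fixes y :: "nat \<Rightarrow> 'a::euclidean_space"
  assumes X: "convex X" "closed X" and y1: "y 1 \<in> X" and \<gamma>: "\<gamma> \<ge> 0"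
    and step: "\<And>i. i \<in> {1..m} \<Longrightarrow> y (i + 1) = closest_point X (y i - \<gamma> *\<^sub>R G i (y i))"
    and D: "\<And>i z. i \<in> {1..m} \<Longrightarrow> z \<in> X \<Longrightarrow> norm (G i z) \<le> D"
  shows "j \<le> m \<Longrightarrow> norm (y (j + 1) - y 1) \<le> real j * \<gamma> * D"
proof (induction j)
  case (Suc j)
  have yj: "y (j + 1) \<in> X"
    by (rule incremental_cycle_in_set[where G = G, OF X y1 step]) (use Suc.prems in auto)
  have "y (Suc j + 1) = closest_point X (y (j + 1) - \<gamma> *\<^sub>R G (j + 1) (y (j + 1)))"
    using step[of "j + 1"] Suc.prems by simp
  then have "norm (y (Suc j + 1) - y (j + 1)) \<le> norm (y (j + 1) - \<gamma> *\<^sub>R G (j + 1) (y (j + 1)) - y (j + 1))"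
    by (simp only: closest_point_dist_le[OF X yj])
  also have "\<dots> = \<gamma> * norm (G (j + 1) (y (j + 1)))"
    using \<gamma> by simp
  also have "\<dots> \<le> \<gamma> * D"
    using D[OF _ yj] \<gamma> Suc.prems by (intro mult_left_mono) auto
  finally have "norm (y (Suc j + 1) - y (j + 1)) \<le> \<gamma> * D" .
  moreover have "norm (y (Suc j + 1) - y 1) \<le> norm (y (Suc j + 1) - y (j + 1)) + norm (y (j + 1) - y 1)"
    by (rule norm_triangle_sub[of _ "y (j + 1) - y 1", simplified, THEN order_trans])
       (simp add: add.commute)
  ultimately show ?case
    using Suc.IH Suc.prems by (simp add: algebra_simps)
qed simp

text \<open>The error \<open>(j \<gamma> D)\<^sup>2\<close> collects the squared step lengths, \<open>\<gamma>\<^sup>2 D\<^sup>2\<close> each, and the cost of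
  replacing the current point by \<open>y 1\<close> in the linear term, which is \<open>2 j (\<gamma> D)\<^sup>2\<close> at the point \<open>y (j + 1)\<close>.\<close>

lemma incremental_cycle_expansion:
  fixes y :: "nat \<Rightarrow> 'a::euclidean_space"
  assumes X: "convex X" "closed X" and y1: "y 1 \<in> X" and w: "w \<in> X" and \<gamma>: "\<gamma> \<ge> 0"
    and step: "\<And>i. i \<in> {1..m} \<Longrightarrow> y (i + 1) = closest_point X (y i - \<gamma> *\<^sub>R G i (y i))"
    and D: "\<And>i z. i \<in> {1..m} \<Longrightarrow> z \<in> X \<Longrightarrow> norm (G i z) \<le> D"
    and sm: "\<And>i z. i \<in> {1..m} \<Longrightarrow> z \<in> X \<Longrightarrow>
      \<nu> * (norm (z - w))\<^sup>2 \<le> (G i z - G i w) \<bullet> (z - w)"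
  shows "j \<le> m \<Longrightarrow> (norm (y (j + 1) - w))\<^sup>2
    \<le> (norm (y 1 - w))\<^sup>2 - 2 * \<gamma> * ((\<Sum>i=1..j. G i w) \<bullet> (y 1 - w))
      - 2 * \<gamma> * \<nu> * (\<Sum>i=1..j. (norm (y i - w))\<^sup>2) + (real j * \<gamma> * D)\<^sup>2"
proof (induction j)
  case (Suc j)
  let ?i = "j + 1"
  let ?z = "y ?i"
  have i: "?i \<in> {1..m}" and j: "j \<le> m" using Suc.prems by auto
  have z: "?z \<in> X" using incremental_cycle_in_set[where G = G, OF X y1 step j] .
  have D0: "0 \<le> D" using D[OF i w] norm_ge_zero order_trans by blast
  have "(norm (y (Suc j + 1) - w))\<^sup>2 \<le> (norm (?z - \<gamma> *\<^sub>R G ?i ?z - w))\<^sup>2"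
    using step[OF i] closest_point_dist_le[OF X w] by (simp add: power_mono)
  also have "\<dots> = (norm (?z - w))\<^sup>2 - 2 * \<gamma> * (G ?i ?z \<bullet> (?z - w)) + \<gamma>\<^sup>2 * (norm (G ?i ?z))\<^sup>2"
    unfolding power2_norm_eq_inner
    by (simp add: inner_diff_left inner_diff_right inner_commute algebra_simps power2_eq_square)
  also have "\<dots> \<le> (norm (?z - w))\<^sup>2 - 2 * \<gamma> * (G ?i ?z \<bullet> (?z - w)) + \<gamma>\<^sup>2 * D\<^sup>2"
    using D[OF i z] by (auto intro!: mult_left_mono power_mono)
  finally have 1: "(norm (y (Suc j + 1) - w))\<^sup>2
      \<le> (norm (?z - w))\<^sup>2 - 2 * \<gamma> * (G ?i ?z \<bullet> (?z - w)) + \<gamma>\<^sup>2 * D\<^sup>2" .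
  have "- (G ?i w \<bullet> (?z - y 1)) \<le> norm (G ?i w) * norm (?z - y 1)"
    using Cauchy_Schwarz_ineq2[of "G ?i w" "?z - y 1"] by linarith
  also have "\<dots> \<le> D * (real j * \<gamma> * D)"
    using D[OF i w] incremental_cycle_dist_start[where G = G, OF X y1 \<gamma> step D j] D0
    by (intro mult_mono) auto
  finally have "G ?i w \<bullet> (y 1 - w) + \<nu> * (norm (?z - w))\<^sup>2 - D * (real j * \<gamma> * D) \<le> G ?i ?z \<bullet> (?z - w)"
    using sm[OF i z] by (simp add: inner_diff_left inner_diff_right)
  then have "2 * \<gamma> * (G ?i w \<bullet> (y 1 - w) + \<nu> * (norm (?z - w))\<^sup>2 - D * (real j * \<gamma> * D))
      \<le> 2 * \<gamma> * (G ?i ?z \<bullet> (?z - w))"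
    using \<gamma> by (intro mult_left_mono) auto
  then have "(norm (y (Suc j + 1) - w))\<^sup>2 \<le> (norm (?z - w))\<^sup>2
      - 2 * \<gamma> * (G ?i w \<bullet> (y 1 - w)) - 2 * \<gamma> * \<nu> * (norm (?z - w))\<^sup>2
      + (2 * real j + 1) * (\<gamma> * D)\<^sup>2"
    using 1 by (simp add: algebra_simps power2_eq_square)
  then show ?case
    using Suc.IH[OF j] by (simp add: inner_add_left algebra_simps power2_eq_square)
qed simp

lemma incremental_cycle_contraction:
  fixes y :: "nat \<Rightarrow> 'a::euclidean_space"
  assumes X: "convex X" "closed X" and y1: "y 1 \<in> X" and m: "m \<ge> 1"
    and w: "VI_solution X (\<lambda>z. \<Sum>i=1..m. G i z) w" and \<gamma>: "\<gamma> \<ge> 0" and \<nu>: "\<nu> \<ge> 0"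
    and step: "\<And>i. i \<in> {1..m} \<Longrightarrow> y (i + 1) = closest_point X (y i - \<gamma> *\<^sub>R G i (y i))"
    and D: "\<And>i z. i \<in> {1..m} \<Longrightarrow> z \<in> X \<Longrightarrow> norm (G i z) \<le> D"
    and sm: "\<And>i z. i \<in> {1..m} \<Longrightarrow> z \<in> X \<Longrightarrow>
      \<nu> * (norm (z - w))\<^sup>2 \<le> (G i z - G i w) \<bullet> (z - w)"
  shows "(norm (y (m + 1) - w))\<^sup>2 \<le> (1 - 2 * \<gamma> * \<nu>) * (norm (y 1 - w))\<^sup>2 + (real m * \<gamma> * D)\<^sup>2"
proof -
  have wX: "w \<in> X" and vi: "0 \<le> (\<Sum>i=1..m. G i w) \<bullet> (y 1 - w)"
    using w y1 by (auto simp: VI_solution_def inner_commute)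
  \<comment> \<open>Only the first of the \<open>m\<close> strong monotonicity terms is kept.\<close>
  have "(norm (y 1 - w))\<^sup>2 \<le> (\<Sum>i=1..m. (norm (y i - w))\<^sup>2)"
    using m by (intro member_le_sum) auto
  then have "2 * \<gamma> * \<nu> * (norm (y 1 - w))\<^sup>2 \<le> 2 * \<gamma> * \<nu> * (\<Sum>i=1..m. (norm (y i - w))\<^sup>2)"
    using \<gamma> \<nu> by (intro mult_left_mono) auto
  moreover have "0 \<le> 2 * \<gamma> * ((\<Sum>i=1..m. G i w) \<bullet> (y 1 - w))"
    using \<gamma> vi by simp
  moreover have "(1 - 2 * \<gamma> * \<nu>) * (norm (y 1 - w))\<^sup>2 =
      (norm (y 1 - w))\<^sup>2 - 2 * \<gamma> * \<nu> * (norm (y 1 - w))\<^sup>2"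
    by (simp add: algebra_simps)
  ultimately show ?thesis
    using incremental_cycle_expansion[where G = G and m = m and j = m, OF X y1 wX \<gamma> step D sm order_refl]
    by linarith
qed

section \<open>Scalar estimates\<close>

lemma norm_add_square_le_Young:
  fixes u v :: "'a::real_inner"
  assumes p: "p > 0"
  shows "(norm (u + v))\<^sup>2 \<le> (1 + p) * (norm u)\<^sup>2 + (1 + 1 / p) * (norm v)\<^sup>2"
proof -
  have "0 \<le> (p * norm u - norm v)\<^sup>2 / p" using p by simp
  also have "\<dots> = p * (norm u)\<^sup>2 + (norm v)\<^sup>2 / p - 2 * norm u * norm v"
    using p by (simp add: power2_eq_square field_simps)
  finally have "2 * norm u * norm v \<le> p * (norm u)\<^sup>2 + (norm v)\<^sup>2 / p" by simp
  moreover have "(norm (u + v))\<^sup>2 \<le> (norm u + norm v)\<^sup>2"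
    by (intro power_mono norm_triangle_ineq) auto
  ultimately show ?thesis
    by (simp add: power2_sum algebra_simps)
qed

text \<open>Distances are measured to \<open>u\<close> in the assumption and to \<open>v\<close> in the conclusion. Young's inequality
  with parameter \<open>p\<close> turns the factor \<open>1 - 2 p\<close> into at most \<open>1 - p\<close>.\<close>

lemma contraction_change_reference:
  fixes z u v :: "'a::real_inner"
  assumes p: "0 < p" "2 * p \<le> 1"
    and A: "A \<le> (1 - 2 * p) * (norm (z - u))\<^sup>2 + E"
    and d: "norm (v - u) \<le> d"
  shows "A \<le> (1 - p) * (norm (z - v))\<^sup>2 + d\<^sup>2 / p + E"
proof -
  have "(norm (z - u))\<^sup>2 \<le> (1 + p) * (norm (z - v))\<^sup>2 + (1 + 1 / p) * (norm (v - u))\<^sup>2"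
    using norm_add_square_le_Young[OF p(1), of "z - v" "v - u"] by simp
  also have "\<dots> \<le> (1 + p) * (norm (z - v))\<^sup>2 + (1 + 1 / p) * d\<^sup>2"
    using d p by (auto intro!: mult_left_mono power_mono)
  finally have "(1 - 2 * p) * (norm (z - u))\<^sup>2
      \<le> (1 - 2 * p) * ((1 + p) * (norm (z - v))\<^sup>2 + (1 + 1 / p) * d\<^sup>2)"
    using p by (intro mult_left_mono) auto
  also have "\<dots> = (1 - p - 2 * p\<^sup>2) * (norm (z - v))\<^sup>2 + (1 / p - 1 - 2 * p) * d\<^sup>2"
    using p by (simp add: field_simps power2_eq_square)
  also have "\<dots> \<le> (1 - p) * (norm (z - v))\<^sup>2 + 1 / p * d\<^sup>2"
    using p by (intro add_mono mult_right_mono) auto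
  finally show ?thesis using A by simp
qed

lemma powr_ratio_minus_one_le:
  fixes s b :: real
  assumes s: "s \<ge> 2" and b: "0 < b" "b \<le> 1 / 2"
  shows "(s / (s - 1)) powr b - 1 \<le> 1 / s"
proof -
  \<comment> \<open>Passing to the exponent \<open>1 / 2\<close> leaves \<open>s\<^sup>3 \<le> (s + 1)\<^sup>2 (s - 1)\<close>, that is \<open>s + 1 \<le> s\<^sup>2\<close>.\<close>
  have "(s / (s - 1)) powr b \<le> (s / (s - 1)) powr (1 / 2)"
    using s b by (intro powr_mono) auto
  also have "\<dots> = sqrt (s / (s - 1))"
    using s by (simp add: powr_half_sqrt)
  also have "\<dots> \<le> 1 + 1 / s"
  proof (rule real_le_lsqrt)
    have "s * s\<^sup>2 \<le> (s + 1)\<^sup>2 * (s - 1)"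
    proof -
      have "2 * s \<le> s * s" using s by (intro mult_right_mono) auto
      then have "1 + s \<le> s * s" using s by linarith
      then show ?thesis by (simp add: power2_eq_square algebra_simps)
    qed
    then show "s / (s - 1) \<le> (1 + 1 / s)\<^sup>2"
      using s by (simp add: field_simps power2_eq_square)
  qed (use s in auto)
  finally show ?thesis by simp
qed

lemma powr_decrease_le:
  fixes s c :: real
  assumes s: "s > 1" and c: "0 \<le> c" "c \<le> 1"
  shows "(1 - 1 / s) * (s - 1) powr (- c) \<le> s powr (- c)"
proof -
  have "1 - 1 / s = ((s - 1) / s) powr 1"
    using s by (simp add: field_simps)
  also have "\<dots> \<le> ((s - 1) / s) powr c"
    using s c by (intro powr_mono') auto
  also have "\<dots> = (s - 1) powr c / s powr c"
    using s by (simp add: powr_divide)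
  finally have "(1 - 1 / s) * (s - 1) powr (- c) \<le> (s - 1) powr c / s powr c * (s - 1) powr (- c)"
    by (intro mult_right_mono) auto
  also have "\<dots> = s powr (- c)"
    using s by (simp add: powr_minus field_simps)
  finally show ?thesis .
qed

text \<open>The rate \<open>s\<^bsup>-c\<^esup>\<close> is preserved by a contraction with factor \<open>1 - p\<close> and error \<open>p s\<^bsup>-c\<^esup>\<close> as soon
  as half of \<open>p\<close> dominates the relative decrease \<open>1 / s\<close>; this is where \<open>\<tau> \<ge> 2\<close> enters.\<close>

lemma power_rate_recursion_step:
  fixes s c p \<tau> :: real
  assumes s: "s > 1" and c: "0 \<le> c" "c \<le> 1" and p: "2 / s \<le> p" and \<tau>: "\<tau> \<ge> 2"
  shows "(1 - p) * (\<tau> * (s - 1) powr (- c)) + p * s powr (- c) \<le> \<tau> * s powr (- c)"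
proof -
  define q where "q = s powr (- c)"
  define q' where "q' = (s - 1) powr (- c)"
  have p0: "p \<ge> 0" using p s by (smt (verit) divide_nonneg_nonneg)
  have q': "q' \<ge> 0" by (simp add: q'_def)
  have qq: "q \<le> q'"
    using s c unfolding q_def q'_def by (intro powr_mono2') auto
  have "(1 - 1 / s) * q' \<le> q"
    unfolding q_def q'_def by (rule powr_decrease_le[OF s c])
  moreover have "1 / s * q' \<le> p / 2 * q'"
    using p q' by (intro mult_right_mono) auto
  ultimately have "(1 - p / 2) * q' \<le> q" unfolding left_diff_distrib by linarith
  then have 1: "\<tau> * ((1 - p / 2) * q') \<le> \<tau> * q" using \<tau> by (intro mult_left_mono) auto
  have "p * q \<le> p * q'" using qq p0 by (intro mult_left_mono)
  also have "\<dots> \<le> (\<tau> / 2) * (p * q')"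
    using \<tau> p0 q' mult_right_mono[of 1 "\<tau> / 2" "p * q'"] by simp
  finally have "p * q \<le> \<tau> * p * q' / 2" by simp
  then show ?thesis using 1 unfolding q_def[symmetric] q'_def[symmetric]
    by (simp add: algebra_simps)
qed

section \<open>The convergence rate\<close>

theorem theorem2:
  fixes X :: "(real ^ 'n) set"
    and m :: nat
    and F grad :: "nat \<Rightarrow> real ^ 'n \<Rightarrow> real ^ 'n"
    and f :: "nat \<Rightarrow> real ^ 'n \<Rightarrow> real"
    and \<mu> :: "nat \<Rightarrow> real"
    and C\<^sub>F C\<^sub>f \<mu>min \<gamma> \<eta> \<Gamma> a b B\<^sub>0 \<tau> :: real
    and \<gamma>s \<eta>s :: "nat \<Rightarrow> real"
    and x :: "nat \<Rightarrow> nat \<Rightarrow> real ^ 'n"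
  assumes m: "m \<ge> 1"
    and X: "X \<noteq> {}" "convex X" "compact X"
    and F_continuous: "\<And>i. i \<in> {1..m} \<Longrightarrow> continuous_on UNIV (F i)"
    and F_monotone: "\<And>i. i \<in> {1..m} \<Longrightarrow> monotone_operator (F i)"
    and f_gradient: "\<And>i z. i \<in> {1..m} \<Longrightarrow> GDERIV (f i) z :> grad i z"
    and f_C1: "\<And>i. i \<in> {1..m} \<Longrightarrow> continuous_on UNIV (grad i)"
    and f_strongly_convex: "\<And>i. i \<in> {1..m} \<Longrightarrow> strongly_convex_on X (\<mu> i) (f i)"
    and \<mu>min: "\<mu>min = Min (\<mu> ` {1..m})" "\<mu>min > 0"
    and C_pos: "C\<^sub>F > 0" "C\<^sub>f > 0"
    and F_bound: "\<And>i z. i \<in> {1..m} \<Longrightarrow> z \<in> X \<Longrightarrow> norm (F i z) \<le> C\<^sub>F / m"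
    and grad_bound: "\<And>i z. i \<in> {1..m} \<Longrightarrow> z \<in> X \<Longrightarrow> norm (grad i z) \<le> C\<^sub>f / m"
    and pos: "\<gamma> > 0" "\<eta> > 0" "\<Gamma> > 0" "a > 0" "b > 0"
    and exponents: "a > b" "a + b < 1" "3 * a + b < 2"
    and \<Gamma>: "\<Gamma> \<ge> 1" "\<Gamma> powr (a + b) \<ge> 2 * \<gamma> * \<eta> * \<mu>min"
      "\<Gamma> powr (1 - a - b) \<ge> 4 / (\<gamma> * \<eta> * \<mu>min)"
    and stepsize: "\<And>k. \<gamma>s k = \<gamma> / (real k + \<Gamma>) powr a"
    and regularization: "\<And>k. \<eta>s k = \<eta> / (real k + \<Gamma>) powr b"
    and x_init: "x 0 1 \<in> X"
    and x_inner: "\<And>k i. i \<in> {1..m} \<Longrightarrow>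
      x k (i + 1) = closest_point X (x k i - \<gamma>s k *\<^sub>R (F i (x k i) + \<eta>s k *\<^sub>R grad i (x k i)))"
    and x_outer: "\<And>k. x (k + 1) 1 = x k (m + 1)"
    and B\<^sub>0: "B\<^sub>0 = (3 / 2) * C\<^sub>f\<^sup>2
                / ((real m)\<^sup>2 * \<mu>min ^ 3 * \<gamma> ^ 3 * \<eta> * \<Gamma> powr (2 - 3 * a - b))
              + (C\<^sub>F + \<eta>s 0 * C\<^sub>f)\<^sup>2"
    and \<tau>: "\<tau> = max (\<mu>min * \<eta> * inverse \<gamma> * inverse B\<^sub>0 * \<Gamma> powr (a - b)
                    * (norm (x 1 1 - tikhonov_point X m F grad (\<eta>s 0)))\<^sup>2) 2"
  shows "\<forall>k. \<forall>i\<in>{1..m}.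
    (norm (x (k + 1) i - tikhonov_point X m F grad (\<eta>s k)))\<^sup>2
      \<le> 2 * (real i - 1)\<^sup>2 * (C\<^sub>F + \<eta>s 0 * C\<^sub>f)\<^sup>2 * \<gamma>\<^sup>2
            / ((real m)\<^sup>2 * (real k + \<Gamma> + 1) powr (2 * a))
        + 2 * \<tau> * B\<^sub>0 * \<gamma> / (\<mu>min * \<eta> * (real k + \<Gamma>) powr (a - b))"
proof -
  \<comment> \<open>The index of \<open>e\<close> is that of the Tikhonov point, one less than that of the iterate. The bound
    on \<open>e k\<close> is \<open>\<tau> K (k + \<Gamma>)\<^bsup>b-a\<^esup>\<close>, and \<open>p k = P (k + \<Gamma>)\<^bsup>-(a+b)\<^esup>\<close>.\<close>
  define T where "T k = tikhonov_point X m F grad (\<eta>s k)" for k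
  define s where "s k = real k + \<Gamma>" for k
  define C where "C = C\<^sub>F + \<eta>s 0 * C\<^sub>f"
  define P where "P = \<gamma> * \<eta> * \<mu>min"
  define p where "p k = \<gamma>s k * (\<eta>s k * \<mu>min)" for k
  define K where "K = B\<^sub>0 * \<gamma> / (\<mu>min * \<eta>)"
  define e where "e k = (norm (x (k + 1) 1 - T k))\<^sup>2" for k
  have cl: "closed X" using X by (simp add: compact_imp_closed)
  have m0: "real m > 0" using m by simp
  have sG: "\<Gamma> \<le> s k" "0 < s k" for k using pos by (auto simp: s_def)
  have P0: "P > 0" using pos \<mu>min(2) by (simp add: P_def)
  have \<gamma>s_eq: "\<gamma>s k = \<gamma> * s k powr (- a)" and \<eta>s_eq: "\<eta>s k = \<eta> * s k powr (- b)" for k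
    by (simp_all add: stepsize regularization s_def powr_minus divide_inverse)
  have \<gamma>s0: "\<gamma>s k > 0" and \<eta>s0: "\<eta>s k > 0" for k
    using sG(2)[of k] pos by (simp_all add: \<gamma>s_eq \<eta>s_eq)
  have \<eta>s_le: "\<eta>s k \<le> \<eta>s 0" for k
    unfolding \<eta>s_eq using pos
    by (intro mult_left_mono powr_mono2') (auto simp: s_def)
  have p_eq: "p k = P * s k powr (- (a + b))" for k
    by (simp add: p_def P_def \<gamma>s_eq \<eta>s_eq powr_add[symmetric])
  have p0: "p k > 0" for k using \<gamma>s0 \<eta>s0 \<mu>min(2) by (simp add: p_def)
  have C0: "C > 0" using C_pos \<eta>s0 by (simp add: C_def add_pos_pos)
  have B0: "B\<^sub>0 > 0"
    unfolding B\<^sub>0 C_def[symmetric] using C0 pos \<mu>min(2) m0 C_pos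
    by (intro add_nonneg_pos) auto
  have K0: "K > 0" using B0 pos \<mu>min(2) by (simp add: K_def)

  have g_mono: "\<mu>min * (norm (u - v))\<^sup>2 \<le> (grad i u - grad i v) \<bullet> (u - v)"
    if "i \<in> {1..m}" "u \<in> X" "v \<in> X" for i u v
  proof -
    have "\<mu>min \<le> \<mu> i" unfolding \<mu>min(1) using that by (intro Min_le) auto
    then have "\<mu>min * (norm (u - v))\<^sup>2 \<le> \<mu> i * (norm (u - v))\<^sup>2" by (intro mult_right_mono) auto
    also have "\<dots> \<le> (grad i u - grad i v) \<bullet> (u - v)"
      by (rule strongly_convex_on_gradient_strongly_monotone[OF f_strongly_convex])
         (use that f_gradient in auto)
    finally show ?thesis .
  qed
  have F_mono: "0 \<le> (F i u - F i v) \<bullet> (u - v)" if "i \<in> {1..m}" for i u v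
    using F_monotone[OF that] by (simp add: monotone_operator_def)
  have cont: "continuous_on X (F i)" "continuous_on X (grad i)" if "i \<in> {1..m}" for i
    using F_continuous f_C1 that by (auto intro: continuous_on_subset)
  have T_VI: "VI_solution X (\<lambda>z. \<Sum>i=1..m. F i z + \<eta>s k *\<^sub>R grad i z) (T k)" for k
    unfolding T_def
    by (rule VI_solution_tikhonov_point[OF X m \<mu>min(2) \<eta>s0 cont F_mono g_mono])
  then have TX: "T k \<in> X" for k by (auto simp: VI_solution_def)

  have in_X: "x k 1 \<in> X" for k
  proof (induction k)
    case (Suc k)
    have "x k (m + 1) \<in> X"
      by (rule incremental_cycle_in_set[where
        G = "\<lambda>i z. F i z + \<eta>s k *\<^sub>R grad i z",
        OF X(2) cl Suc.IH x_inner]) auto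
    then show ?case using x_outer[of k] by simp
  qed (rule x_init)
  have step_bound: "norm (F i z + \<eta>s k *\<^sub>R grad i z) \<le> C / real m"
    if "i \<in> {1..m}" "z \<in> X" for i z k
  proof -
    have "norm (F i z + \<eta>s k *\<^sub>R grad i z) \<le> norm (F i z) + \<eta>s k * norm (grad i z)"
      using norm_triangle_ineq[of "F i z" "\<eta>s k *\<^sub>R grad i z"] \<eta>s0[of k] by simp
    also have "\<dots> \<le> C\<^sub>F / real m + \<eta>s 0 * (C\<^sub>f / real m)"
      using F_bound[OF that] grad_bound[OF that] \<eta>s_le[of k] \<eta>s0[of 0]
      by (intro add_mono mult_mono) auto
    finally show ?thesis by (simp add: C_def add_divide_distrib)
  qed
  have cycle: "e k \<le> (1 - 2 * p k) * (norm (x k 1 - T k))\<^sup>2 + (\<gamma>s k * C)\<^sup>2" for k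
  proof -
    have "(norm (x k (m + 1) - T k))\<^sup>2 \<le> (1 - 2 * \<gamma>s k * (\<eta>s k * \<mu>min)) * (norm (x k 1 - T k))\<^sup>2
        + (real m * \<gamma>s k * (C / real m))\<^sup>2"
    proof (rule incremental_cycle_contraction[where
        G = "\<lambda>i z. F i z + \<eta>s k *\<^sub>R grad i z",
        OF X(2) cl in_X m T_VI _ _ x_inner step_bound])
      fix i z assume iz: "i \<in> {1..m}" "z \<in> X"
      have "\<eta>s k * (\<mu>min * (norm (z - T k))\<^sup>2) \<le> \<eta>s k * ((grad i z - grad i (T k)) \<bullet> (z - T k))"
        using g_mono[OF iz TX] \<eta>s0[of k] by simp
      then show "\<eta>s k * \<mu>min * (norm (z - T k))\<^sup>2
          \<le> (F i z + \<eta>s k *\<^sub>R grad i z - (F i (T k) + \<eta>s k *\<^sub>R grad i (T k))) \<bullet> (z - T k)"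
        using F_mono[OF iz(1), of z "T k"] by (simp add: inner_diff_left inner_add_left algebra_simps)
    qed (use \<gamma>s0[of k] \<eta>s0[of k] \<mu>min(2) in auto)
    then show ?thesis
      using m0 x_outer[of k] by (simp add: e_def p_def mult.assoc)
  qed

  have drift: "norm (T j - T (Suc j)) \<le> C\<^sub>f / (real m * \<mu>min) * (1 / s (Suc j))" for j
  proof -
    have s2: "s (Suc j) \<ge> 2" and sj: "s j = s (Suc j) - 1" using \<Gamma> by (auto simp: s_def)
    have "\<bar>\<eta>s j - \<eta>s (Suc j)\<bar> / \<eta>s (Suc j) = \<eta>s j / \<eta>s (Suc j) - 1"
    proof -
      have "\<eta>s (Suc j) \<le> \<eta>s j"
        unfolding \<eta>s_eq using pos by (intro mult_left_mono powr_mono2') (auto simp: s_def)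
      then show ?thesis using \<eta>s0[of "Suc j"] by (simp add: field_simps)
    qed
    also have "\<dots> = (s (Suc j) / (s (Suc j) - 1)) powr b - 1"
      using sG(2)[of j] sG(2)[of "Suc j"] pos unfolding \<eta>s_eq sj[symmetric]
      by (simp add: powr_minus powr_divide field_simps)
    also have "\<dots> \<le> 1 / s (Suc j)"
      using exponents pos by (intro powr_ratio_minus_one_le s2) auto
    finally have r: "\<bar>\<eta>s j - \<eta>s (Suc j)\<bar> / \<eta>s (Suc j) \<le> 1 / s (Suc j)" .
    have "norm (T (Suc j) - T j) \<le> C\<^sub>f / (real m * \<mu>min) * (\<bar>\<eta>s j - \<eta>s (Suc j)\<bar> / \<eta>s (Suc j))"
      unfolding T_def
      by (rule tikhonov_point_drift[OF X m \<mu>min(2) \<eta>s0 \<eta>s0 cont F_mono g_mono grad_bound])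
    also have "\<dots> \<le> C\<^sub>f / (real m * \<mu>min) * (1 / s (Suc j))"
      using r C_pos \<mu>min(2) by (intro mult_left_mono) auto
    finally show ?thesis by (simp add: norm_minus_commute)
  qed

  \<comment> \<open>The drift term carries the power \<open>a + b - 2 = - 2 a - r\<close> with \<open>r = 2 - 3 a - b > 0\<close>, so it is
    of the order of \<open>\<gamma>\<^sub>k\<^sup>2\<close>; the factor \<open>3 / 2\<close> in \<open>B\<^sub>0\<close> is slack here.\<close>
  have error: "(C\<^sub>f / (real m * \<mu>min) * (1 / s k))\<^sup>2 / p k + (\<gamma>s k * C)\<^sup>2 \<le> B\<^sub>0 * (\<gamma>s k)\<^sup>2" for k
  proof -
    define A where "A = C\<^sub>f\<^sup>2 / ((real m)\<^sup>2 * \<mu>min ^ 3 * \<gamma> * \<eta>)"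
    define r where "r = 2 - 3 * a - b"
    have A0: "A \<ge> 0" using pos \<mu>min(2) by (simp add: A_def)
    have s: "s k > 0" by (rule sG)
    have s2: "(s k)\<^sup>2 = s k powr 2" using s by simp
    have "(C\<^sub>f / (real m * \<mu>min) * (1 / s k))\<^sup>2 / p k = A * (s k powr (a + b) / s k powr 2)"
      unfolding p_eq P_def A_def s2[symmetric] powr_minus using pos \<mu>min(2) m0 s
      by (simp add: field_simps power2_eq_square power3_eq_cube)
    also have "\<dots> = A * (s k powr (- r) * s k powr (- (2 * a)))"
      by (simp add: r_def powr_diff[symmetric] powr_add[symmetric] algebra_simps)
    also have "\<dots> \<le> A * (\<Gamma> powr (- r) * s k powr (- (2 * a)))"
      using A0 sG(1)[of k] pos exponents
      by (intro mult_left_mono mult_right_mono powr_mono2') (auto simp: r_def)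
    also have "\<dots> = (A * \<Gamma> powr (- r)) * s k powr (- (2 * a))" by simp
    also have "\<dots> \<le> (3 / 2 * (A * \<Gamma> powr (- r))) * s k powr (- (2 * a))"
      using A0 by (intro mult_right_mono) auto
    also have "\<dots> = 3 / 2 * C\<^sub>f\<^sup>2 / ((real m)\<^sup>2 * \<mu>min ^ 3 * \<gamma> ^ 3 * \<eta> * \<Gamma> powr r)
        * (\<gamma>\<^sup>2 * s k powr (- (2 * a)))"
      using pos by (simp add: A_def powr_minus field_simps power2_eq_square power3_eq_cube)
    also have "\<gamma>\<^sup>2 * s k powr (- (2 * a)) = (\<gamma>s k)\<^sup>2"
      by (simp add: \<gamma>s_eq power_mult_distrib power2_eq_square powr_add[symmetric])
    finally show ?thesis
      unfolding B\<^sub>0 C_def[symmetric] r_def[symmetric] distrib_right power_mult_distrib[of "\<gamma>s k" C]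
        mult.commute[of "C\<^sup>2"]
      by (rule add_right_mono)
  qed

  have rate: "e k \<le> \<tau> * K * s k powr (- (a - b))" for k
  proof (induction k)
    case 0
    \<comment> \<open>The first entry of the maximum in \<open>\<tau>\<close> is \<open>e 0\<close> divided by \<open>K \<Gamma>\<^bsup>b-a\<^esup>\<close>.\<close>
    define Z where "Z = \<mu>min * \<eta> * inverse \<gamma> * inverse B\<^sub>0 * \<Gamma> powr (a - b)"
    have "Z * e 0 \<le> \<tau>"
      unfolding \<tau> Z_def e_def T_def by simp
    then have "Z * e 0 * (K * \<Gamma> powr (- (a - b))) \<le> \<tau> * (K * \<Gamma> powr (- (a - b)))"
      using K0 by (intro mult_right_mono) auto
    also have "Z * e 0 * (K * \<Gamma> powr (- (a - b))) = e 0"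
    proof -
      have "\<Gamma> powr (a - b) * \<Gamma> powr (- (a - b)) = 1"
        using pos by (simp add: powr_add[symmetric])
      moreover have "\<mu>min * \<eta> * inverse \<gamma> * inverse B\<^sub>0 * K = 1"
        using pos \<mu>min(2) B0 by (simp add: K_def field_simps)
      moreover have "Z * e 0 * (K * \<Gamma> powr (- (a - b))) =
        (\<mu>min * \<eta> * inverse \<gamma> * inverse B\<^sub>0 * K) * (\<Gamma> powr (a - b) * \<Gamma> powr (- (a - b))) * e 0"
        by (simp add: Z_def mult_ac)
      ultimately show ?thesis by simp
    qed
    finally show ?case by (simp add: s_def mult.assoc)
  next
    case (Suc j)
    let ?s = "s (Suc j)" and ?p = "p (Suc j)"
    have s2: "?s \<ge> 2" and sj: "s j = ?s - 1" using \<Gamma> by (auto simp: s_def)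
    have "2 * P \<le> \<Gamma> powr (a + b)" using \<Gamma>(2) by (simp add: P_def)
    also have "\<dots> \<le> ?s powr (a + b)" using pos sG by (intro powr_mono2) auto
    finally have p1: "2 * ?p \<le> 1"
      unfolding p_eq powr_minus using s2 by (simp add: field_simps)
    have "2 / P \<le> 4 / P" using P0 by (simp add: divide_right_mono)
    also have "\<dots> \<le> \<Gamma> powr (1 - a - b)" using \<Gamma>(3) by (simp add: P_def)
    also have "\<dots> \<le> ?s powr (1 - a - b)" using pos sG exponents by (intro powr_mono2) auto
    also have "\<dots> = ?s * ?s powr (- (a + b))"
      using s2 powr_add[of ?s 1 "- (a + b)"] by (simp add: algebra_simps)
    finally have p2: "2 / ?s \<le> ?p"
      using P0 s2 by (simp add: p_eq field_simps)
    have "e (Suc j) \<le> (1 - ?p) * (norm (x (Suc j) 1 - T j))\<^sup>2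
        + (C\<^sub>f / (real m * \<mu>min) * (1 / ?s))\<^sup>2 / ?p + (\<gamma>s (Suc j) * C)\<^sup>2"
      by (rule contraction_change_reference[OF p0 p1 cycle drift])
    also have "\<dots> \<le> (1 - ?p) * e j + B\<^sub>0 * (\<gamma>s (Suc j))\<^sup>2"
      using error[of "Suc j"] by (simp add: e_def)
    also have "\<dots> \<le> (1 - ?p) * (\<tau> * K * (?s - 1) powr (- (a - b))) + B\<^sub>0 * (\<gamma>s (Suc j))\<^sup>2"
      using Suc.IH p1 p0[of "Suc j"] unfolding sj by (intro add_right_mono mult_left_mono) auto
    also have "B\<^sub>0 * (\<gamma>s (Suc j))\<^sup>2 = K * (?p * ?s powr (- (a - b)))"
    proof -
      have "?s powr (- (a + b)) * ?s powr (- (a - b)) = ?s powr (- a) * ?s powr (- a)"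
        by (simp add: powr_add[symmetric])
      moreover have "K * P = B\<^sub>0 * \<gamma>\<^sup>2"
        using pos \<mu>min(2) by (simp add: K_def P_def field_simps power2_eq_square)
      moreover have "K * (?p * ?s powr (- (a - b))) = (K * P) * (?s powr (- (a + b)) * ?s powr (- (a - b)))"
        by (simp add: p_eq mult_ac)
      ultimately show ?thesis
        by (simp add: \<gamma>s_eq power2_eq_square mult_ac)
    qed
    also have "(1 - ?p) * (\<tau> * K * (?s - 1) powr (- (a - b))) + K * (?p * ?s powr (- (a - b)))
        = K * ((1 - ?p) * (\<tau> * (?s - 1) powr (- (a - b))) + ?p * ?s powr (- (a - b)))"
      by (simp add: algebra_simps)
    also have "\<dots> \<le> K * (\<tau> * ?s powr (- (a - b)))"
      using K0 s2 p2 exponents pos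
      by (intro mult_left_mono power_rate_recursion_step) (auto simp: \<tau>)
    finally show ?case by (simp add: mult_ac)
  qed

  show ?thesis
  proof (intro allI ballI)
    fix k i
    assume i: "i \<in> {1..m}"
    define D where "D = (real i - 1) * \<gamma>s (k + 1) * (C / real m)"
    have "norm (x (k + 1) (i - 1 + 1) - x (k + 1) 1) \<le> real (i - 1) * \<gamma>s (k + 1) * (C / real m)"
      by (rule incremental_cycle_dist_start[where
        G = "\<lambda>i z. F i z + \<eta>s (k + 1) *\<^sub>R grad i z",
        OF X(2) cl in_X _ x_inner step_bound])
         (use i \<gamma>s0[of "k + 1"] in auto)
    then have inner: "norm (x (k + 1) i - x (k + 1) 1) \<le> D"
      using i by (simp add: D_def of_nat_diff)
    have "(norm (x (k + 1) i - T k))\<^sup>2 \<le> 2 * (norm (x (k + 1) i - x (k + 1) 1))\<^sup>2 + 2 * e k"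
      using norm_add_square_le_Young[of 1 "x (k + 1) i - x (k + 1) 1" "x (k + 1) 1 - T k"]
      by (simp add: e_def)
    also have "\<dots> \<le> 2 * D\<^sup>2 + 2 * (\<tau> * K * s k powr (- (a - b)))"
      using inner rate[of k] by (intro add_mono mult_left_mono power_mono) auto
    also have "2 * D\<^sup>2 = 2 * (real i - 1)\<^sup>2 * C\<^sup>2 * \<gamma>\<^sup>2
        / ((real m)\<^sup>2 * (real k + \<Gamma> + 1) powr (2 * a))"
    proof -
      have "((real k + \<Gamma> + 1) powr a)\<^sup>2 = (real k + \<Gamma> + 1) powr (2 * a)"
        by (simp add: power2_eq_square powr_add[symmetric])
      then show ?thesis
        by (simp add: D_def stepsize power_mult_distrib power_divide add_ac mult_ac)
    qed
    also have "2 * (\<tau> * K * s k powr (- (a - b)))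
        = 2 * \<tau> * B\<^sub>0 * \<gamma> / (\<mu>min * \<eta> * (real k + \<Gamma>) powr (a - b))"
      by (simp only: K_def s_def powr_minus divide_inverse inverse_mult_distrib mult_ac)
    finally show "(norm (x (k + 1) i - tikhonov_point X m F grad (\<eta>s k)))\<^sup>2
      \<le> 2 * (real i - 1)\<^sup>2 * (C\<^sub>F + \<eta>s 0 * C\<^sub>f)\<^sup>2 * \<gamma>\<^sup>2
            / ((real m)\<^sup>2 * (real k + \<Gamma> + 1) powr (2 * a))
        + 2 * \<tau> * B\<^sub>0 * \<gamma> / (\<mu>min * \<eta> * (real k + \<Gamma>) powr (a - b))"
      by (simp only: T_def C_def)
  qed
qed

end
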